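(* Let $q\in\mathbb{C}$ with $0<|q|<1$. Consider the divergent alternating series $\widetilde{F}(q)=\sum_{n=0}^{\infty}(-1)^n(q;q)_n$ with partial sums $s_N=\sum_{n=0}^{N}(-1)^n(q;q)_n$. Then the limits $\widetilde{F}_{+}(q):=\lim_{N\to\infty}s_{2N+1}$ and $\widetilde{F}_{-}(q):=\lim_{N\to\infty}s_{2N}$ exist, and $$\sigma(q)=2\widetilde{F}_{+}(q)+(q;q)_{\infty},\qquad \sigma(q)=2\widetilde{F}_{-}(q)-(q;q)_{\infty},$$ where $\sigma(q):=\sum_{n=0}^{\infty}\frac{q^{n(n+1)/2}}{(-q;q)_n}$.
   Context: The $q$-Pochhammer symbol is $(a;q)_0:=1$, $(a;q)_n:=\prod_{j=0}^{n-1}(1-aq^j)$ for $n\ge 1$, and $(a;q)_\infty:=\lim_{n\to\infty}(a;q)_n$ for $|q|<1$. For an infinite series, $S_+$ denotes the limit of the partial sums whose last summand has odd index and $S_-$ the limit of those whose last summand has even index (the paper calls these the limits of the "odd" and "even" partial sums). *)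

theory Defs
  imports "HOL-Analysis.Analysis"
begin

definition qpochhammer :: "complex \<Rightarrow> complex \<Rightarrow> nat \<Rightarrow> complex" where
  "qpochhammer a q n = (\<Prod>j<n. 1 - a * q ^ j)"

definition qpochhammer_inf :: "complex \<Rightarrow> complex \<Rightarrow> complex" where
  "qpochhammer_inf a q = lim (\<lambda>n. qpochhammer a q n)"

definition partial_sum :: "(nat \<Rightarrow> complex) \<Rightarrow> nat \<Rightarrow> complex" where
  "partial_sum f N = (\<Sum>n\<le>N. f n)"

text \<open>The sign records the parity of the index of the last summand: plus for odd, minus for even.\<close>

definition sum_plus :: "(nat \<Rightarrow> complex) \<Rightarrow> complex" where
  "sum_plus f = lim (\<lambda>N. partial_sum f (2 * N + 1))"

definition sum_minus :: "(nat \<Rightarrow> complex) \<Rightarrow> complex" where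
  "sum_minus f = lim (\<lambda>N. partial_sum f (2 * N))"

definition F_term :: "complex \<Rightarrow> nat \<Rightarrow> complex" where
  "F_term q n = (-1) ^ n * qpochhammer q q n"

text \<open>For \<open>norm q < 1\<close> no denominator vanishes; the exponent is an exact division.\<close>

definition sigma_series :: "complex \<Rightarrow> complex" where
  "sigma_series q = (\<Sum>n. q ^ (n * (n + 1) div 2) / qpochhammer (- q) q n)"

end

(* Partial summation gives s_N + s_(N+1) = 1 + sum_(n<=N) (-1)^n q^(n+1) (q;q)_n, while
   s_N - s_(N+1) tends to (q;q)_inf along even N; so it suffices to show
     sigma(q) = 1 + sum_n (-1)^n q^(n+1) (q;q)_n.
   This is a case of a transformation of Fine: G(t) = sum_n (q;q)_n t^n satisfies
   (1 - t) G(t) = 1 - t q G(t q), and iterating from t = -q produces the terms of sigma one by one. *)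

theory Submission
  imports Defs
begin

lemma qpochhammer_0 [simp]: "qpochhammer a q 0 = 1"
  by (simp add: qpochhammer_def)

lemma qpochhammer_Suc: "qpochhammer a q (Suc n) = qpochhammer a q n * (1 - a * q ^ n)"
  by (simp add: qpochhammer_def)

text \<open>This allows division by \<open>1 - t\<close> at the points
  \<open>t = - (q ^ Suc n)\<close> that the iteration visits.\<close>

lemma one_plus_power_nonzero:
  fixes q :: complex
  assumes "norm q < 1"
  shows "1 + q ^ Suc n \<noteq> 0"
proof
  assume "1 + q ^ Suc n = 0"
  then have "norm (q ^ Suc n) = 1"
    by (metis add_eq_0_iff norm_minus_cancel norm_one)
  moreover have "norm (q ^ Suc n) < 1"
    unfolding norm_power using assms by (metis norm_ge_zero power_less_one_iff zero_less_Suc)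
  ultimately show False by simp
qed

text \<open>The sum of \<open>norm (a * q ^ n)\<close> is geometric, so the infinite product
  converges absolutely. A limit of 0 is allowed here, since only the partial products
  matter.\<close>

lemma convergent_qpochhammer:
  assumes "norm q < 1"
  shows "convergent (qpochhammer a q)"
proof -
  have "summable (\<lambda>n. norm (- (a * q ^ n)))"
    using assms by (simp add: norm_mult norm_power summable_mult summable_geometric)
  then have "abs_convergent_prod (\<lambda>n. 1 - a * q ^ n)"
    by (simp add: abs_convergent_prod_conv_summable)
  then have "convergent (\<lambda>n. \<Prod>j\<le>n. 1 - a * q ^ j)"
    using abs_convergent_prod_imp_convergent_prod convergent_prod_imp_convergent by blast
  then have "convergent (\<lambda>n. qpochhammer a q (Suc n))"
    by (simp add: qpochhammer_def lessThan_Suc_atMost)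
  then show ?thesis
    by (rule convergent_Suc_iff[THEN iffD1])
qed

lemma qpochhammer_bounded:
  assumes "norm q < 1"
  obtains B where "\<And>n. norm (qpochhammer a q n) \<le> B"
  using convergent_qpochhammer[OF assms, THEN convergent_imp_Bseq] by (auto simp: Bseq_def)

lemma qpochhammer_tendsto:
  assumes "norm q < 1"
  shows "qpochhammer a q \<longlonglongrightarrow> qpochhammer_inf a q"
  using convergent_qpochhammer[OF assms] by (simp add: convergent_LIMSEQ_iff qpochhammer_inf_def)

text \<open>This is the function G(t) above. For \<open>norm q < 1\<close> the coefficients are
  bounded, so the series converges absolutely on the open unit disc.\<close>

definition qpoch_gf :: "complex \<Rightarrow> complex \<Rightarrow> complex" where
  "qpoch_gf q t = (\<Sum>n. qpochhammer q q n * t ^ n)"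

lemma summable_norm_qpoch_gf:
  assumes "norm q < 1" "norm t < 1"
  shows "summable (\<lambda>n. norm (qpochhammer q q n * t ^ n))"
proof -
  obtain B where B: "\<And>n. norm (qpochhammer q q n) \<le> B"
    using qpochhammer_bounded[OF assms(1)] by blast
  have "summable (\<lambda>n. B * norm t ^ n)"
    using assms by (simp add: summable_mult summable_geometric)
  then show ?thesis
    by (rule summable_comparison_test') (auto simp: norm_mult norm_power intro!: mult_right_mono B)
qed

text \<open>On this disc the series is dominated termwise by its absolute series at
  \<open>t = q\<close>. The disc contains every point \<open>- (q ^ Suc n)\<close>, so one bound
  serves the whole iteration.\<close>

lemma qpoch_gf_bounded:
  assumes "norm q < 1"
  obtains C where "\<And>t. norm t \<le> norm q \<Longrightarrow> norm (qpoch_gf q t) \<le> C"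
proof
  fix t :: complex assume t: "norm t \<le> norm q"
  have s: "summable (\<lambda>n. norm (qpochhammer q q n * t ^ n))"
    using summable_norm_qpoch_gf assms t by simp
  have "norm (qpoch_gf q t) \<le> (\<Sum>n. norm (qpochhammer q q n * t ^ n))"
    unfolding qpoch_gf_def by (rule summable_norm[OF s])
  also have "\<dots> \<le> (\<Sum>n. norm (qpochhammer q q n * q ^ n))"
    by (rule suminf_le)
      (use s t summable_norm_qpoch_gf[OF assms assms] in
        \<open>auto simp: norm_mult norm_power intro!: mult_left_mono power_mono\<close>)
  finally show "norm (qpoch_gf q t) \<le> (\<Sum>n. norm (qpochhammer q q n * q ^ n))" .
qed

text \<open>Split off the constant term and write (q;q)_(n+1) = (q;q)_n - q^(n+1) (q;q)_n. The first
  part sums to t G(t); in the second, the power of q is absorbed into t, giving t q G(t q).\<close>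

lemma qpoch_gf_functional_eq:
  assumes "norm q < 1" "norm t < 1"
  shows "(1 - t) * qpoch_gf q t = 1 - t * q * qpoch_gf q (t * q)"
proof -
  let ?p = "qpochhammer q q"
  have tq: "norm (t * q) < 1"
    using assms by (metis norm_mult_less mult_1)
  have s: "summable (\<lambda>n. ?p n * t ^ n)" "summable (\<lambda>n. ?p n * (t * q) ^ n)"
    by (rule summable_norm_cancel, rule summable_norm_qpoch_gf, fact, fact)+
  have "qpoch_gf q t = 1 + (\<Sum>n. ?p (Suc n) * t ^ Suc n)"
    unfolding qpoch_gf_def using suminf_split_head[OF s(1)] by simp
  also have "(\<lambda>n. ?p (Suc n) * t ^ Suc n) =
      (\<lambda>n. t * (?p n * t ^ n) - t * q * (?p n * (t * q) ^ n))"
    by (auto simp: qpochhammer_Suc power_mult_distrib algebra_simps)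
  also have "suminf \<dots> = t * qpoch_gf q t - t * q * qpoch_gf q (t * q)"
    unfolding qpoch_gf_def
    by (simp only: suminf_diff[OF summable_mult[OF s(1)] summable_mult[OF s(2)], symmetric] suminf_mult[OF s(1), symmetric]
      suminf_mult[OF s(2), symmetric])
  finally show ?thesis by (simp add: algebra_simps)
qed

definition sigma_term :: "complex \<Rightarrow> nat \<Rightarrow> complex" where
  "sigma_term q n = q ^ (n * (n + 1) div 2) / qpochhammer (- q) q n"

text \<open>Consecutive triangular numbers differ by n + 1, and the new factor of the denominator is
  1 - (-q) q^n.\<close>

lemma sigma_term_Suc:
  "sigma_term q (Suc n) = sigma_term q n * (q ^ Suc n / (1 + q ^ Suc n))"
proof -
  have "Suc n * (Suc n + 1) div 2 = n * (n + 1) div 2 + Suc n"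
    by simp
  then show ?thesis
    unfolding sigma_term_def by (simp add: qpochhammer_Suc power_add)
qed

text \<open>The ratio of consecutive terms tends to 0, so it is eventually at most 1/2 and the ratio
  test applies.\<close>

lemma sigma_term_tendsto_0:
  assumes "norm q < 1"
  shows "sigma_term q \<longlonglongrightarrow> 0"
proof -
  have "(\<lambda>n. q ^ Suc n) \<longlonglongrightarrow> 0"
    using assms LIMSEQ_Suc LIMSEQ_power_zero by blast
  then have "(\<lambda>n. q ^ Suc n / (1 + q ^ Suc n)) \<longlonglongrightarrow> 0 / (1 + 0)"
    by (intro tendsto_intros) auto
  then have "(\<lambda>n. norm (q ^ Suc n / (1 + q ^ Suc n))) \<longlonglongrightarrow> 0"
    using tendsto_norm_zero by simp
  then have "eventually (\<lambda>n. norm (q ^ Suc n / (1 + q ^ Suc n)) < 1 / 2) sequentially"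
    by (rule order_tendstoD) simp
  then obtain N where N: "\<And>n. n \<ge> N \<Longrightarrow> norm (q ^ Suc n / (1 + q ^ Suc n)) \<le> 1 / 2"
    by (force simp: eventually_sequentially)
  have "summable (sigma_term q)"
  proof (rule summable_ratio_test)
    fix n assume "n \<ge> N"
    then show "norm (sigma_term q (Suc n)) \<le> 1 / 2 * norm (sigma_term q n)"
      unfolding sigma_term_Suc norm_mult using mult_left_mono[OF N, of n "norm (sigma_term q n)"]
      by (simp add: mult.commute)
  qed simp
  then show ?thesis by (rule summable_LIMSEQ_zero)
qed

lemma sigma_series_eq:
  assumes "norm q < 1"
  shows "sigma_series q = 1 + q * qpoch_gf q (- q)"
proof -
  \<comment> \<open>\<open>A n\<close> is G at the point reached from -q after n substitutions of t
    q for t. \<open>R n\<close> is the remainder then left: 1 + q G(-q) equals the sum of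
    \<open>sigma_term q k\<close> over k \<le> n, plus \<open>R n\<close>.\<close>
  define A where "A n = qpoch_gf q (- (q ^ Suc n))" for n
  define R where "R n = sigma_term q n * q ^ Suc n * A n" for n
  have le: "norm (- (q ^ Suc n)) \<le> norm q" for n
    using assms by (simp add: norm_mult norm_power mult_left_le power_le_one)
  have step: "sigma_term q (Suc n) = R n - R (Suc n)" for n
  proof -
    have "norm (- (q ^ Suc n)) < 1" using le[of n] assms by linarith
    from qpoch_gf_functional_eq[OF assms this]
    have "(1 + q ^ Suc n) * A n = 1 + q ^ Suc (Suc n) * A (Suc n)"
      by (simp add: A_def algebra_simps)
    then have A: "A n = (1 + q ^ Suc (Suc n) * A (Suc n)) / (1 + q ^ Suc n)"
      using one_plus_power_nonzero[OF assms, of n] by (simp only: eq_divide_eq) (simp add: mult.commute)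
    show ?thesis
      unfolding R_def sigma_term_Suc A by (simp add: add_divide_distrib algebra_simps)
  qed
  obtain C where C: "\<And>t. norm t \<le> norm q \<Longrightarrow> norm (qpoch_gf q t) \<le> C"
    using qpoch_gf_bounded[OF assms] by blast
  have "(\<lambda>n. q ^ Suc n) \<longlonglongrightarrow> 0"
    using assms LIMSEQ_Suc LIMSEQ_power_zero by blast
  then have "(\<lambda>n. sigma_term q n * q ^ Suc n) \<longlonglongrightarrow> 0"
    using tendsto_mult_zero sigma_term_tendsto_0[OF assms] by blast
  \<comment> \<open>The remainder is a null sequence times a bounded one.\<close>
  moreover have "Bseq A"
    unfolding A_def using C le by (intro BseqI') blast
  ultimately have "R \<longlonglongrightarrow> 0"
    unfolding R_def tendsto_Zfun_iff by (simp add: bounded_bilinear.Zfun_prod_Bfun[OF bounded_bilinear_mult])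
  then have "(\<lambda>n. R n - R (Suc n)) sums (R 0 - 0)"
    by (rule telescope_sums')
  then have "(\<lambda>n. sigma_term q (Suc n)) sums R 0"
    using step by simp
  \<comment> \<open>Telescoping yields the terms from index 1 on; the term of index 0, which is 1,
    is put back.\<close>
  then have "sigma_term q sums (R 0 + sigma_term q 0)"
    by (simp add: sums_Suc_iff)
  moreover have "sigma_series q = suminf (sigma_term q)"
    by (simp only: sigma_series_def sigma_term_def[abs_def])
  moreover have "R 0 + sigma_term q 0 = 1 + q * qpoch_gf q (- q)"
    by (simp add: R_def A_def sigma_term_def)
  ultimately show ?thesis by (simp add: sums_iff)
qed

lemma partial_sum_F_term_Suc:
  "partial_sum (F_term q) (Suc N) = partial_sum (F_term q) N + F_term q (Suc N)"
  by (simp add: partial_sum_def)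

text \<open>The left side is F_0 plus the sum of F_n + F_(n+1) over n \<le> N. In each pair (q;q)_n
  cancels up to the factor 1 - (1 - q^(n+1)) = q^(n+1), and F_0 = 1.\<close>

lemma partial_sum_F_term_add_Suc:
  "partial_sum (F_term q) N + partial_sum (F_term q) (Suc N) =
    1 + q * (\<Sum>n\<le>N. qpochhammer q q n * (- q) ^ n)"
proof (induction N)
  case 0
  then show ?case by (simp add: partial_sum_def F_term_def qpochhammer_Suc)
next
  case (Suc N)
  let ?s = "partial_sum (F_term q)"
  have "F_term q (Suc N) + F_term q (Suc (Suc N)) = q * (qpochhammer q q (Suc N) * (- q) ^ Suc N)"
    unfolding F_term_def qpochhammer_Suc[of q q "Suc N"] power_minus[of q]
    by (simp add: algebra_simps)
  moreover have "?s (Suc N) + ?s (Suc (Suc N)) =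
      (?s N + ?s (Suc N)) + (F_term q (Suc N) + F_term q (Suc (Suc N)))"
    by (simp add: partial_sum_F_term_Suc)
  ultimately show ?case
    by (simp only: Suc.IH sum.atMost_Suc distrib_left add.assoc)
qed

lemma partial_sum_add_Suc_tendsto:
  assumes "norm q < 1"
  shows "(\<lambda>N. partial_sum (F_term q) N + partial_sum (F_term q) (Suc N)) \<longlonglongrightarrow> sigma_series q"
proof -
  have "summable (\<lambda>n. qpochhammer q q n * (- q) ^ n)"
    using summable_norm_qpoch_gf[of q "- q"] assms summable_norm_cancel by auto
  then show ?thesis
    unfolding partial_sum_F_term_add_Suc sigma_series_eq[OF assms] qpoch_gf_def
    by (intro tendsto_intros summable_LIMSEQ')
qed

theorem theorem1:
  fixes q :: complex
  assumes "0 < norm q" and "norm q < 1"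
  shows "convergent (\<lambda>N. partial_sum (F_term q) (2 * N + 1)) \<and>
         convergent (\<lambda>N. partial_sum (F_term q) (2 * N)) \<and>
         sigma_series q = 2 * sum_plus (F_term q) + qpochhammer_inf q q \<and>
         sigma_series q = 2 * sum_minus (F_term q) - qpochhammer_inf q q"
proof -
  let ?s = "partial_sum (F_term q)" and ?p = "qpochhammer q q"
  have mono: "strict_mono (\<lambda>N::nat. 2 * N)" "strict_mono (\<lambda>N::nat. 2 * N + 1)"
    by (auto simp: strict_mono_def)
  have T: "(\<lambda>N. ?s (2 * N) + ?s (2 * N + 1)) \<longlonglongrightarrow> sigma_series q"
    using LIMSEQ_subseq_LIMSEQ[OF partial_sum_add_Suc_tendsto[OF assms(2)] mono(1)]
    by (simp add: o_def)
  have P: "(\<lambda>N. ?p (2 * N + 1)) \<longlonglongrightarrow> qpochhammer_inf q q"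
    using LIMSEQ_subseq_LIMSEQ[OF qpochhammer_tendsto[OF assms(2)] mono(2)]
    by (simp add: o_def)
  \<comment> \<open>The summand of odd index carries a minus sign. With sum and difference of
    neighbouring partial sums both convergent, each of the two is recovered as half of a
    combination.\<close>
  have diff: "?s (2 * N + 1) = ?s (2 * N) - ?p (2 * N + 1)" for N
    by (simp add: partial_sum_F_term_Suc F_term_def)
  have "(\<lambda>N. (?s (2 * N) + ?s (2 * N + 1) - ?p (2 * N + 1)) / 2)
      \<longlonglongrightarrow> (sigma_series q - qpochhammer_inf q q) / 2"
    by (intro tendsto_intros T P) simp
  then have plus: "(\<lambda>N. ?s (2 * N + 1)) \<longlonglongrightarrow> (sigma_series q - qpochhammer_inf q q) / 2"
    unfolding diff by (simp add: diff_divide_distrib)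
  have "(\<lambda>N. (?s (2 * N) + ?s (2 * N + 1) + ?p (2 * N + 1)) / 2)
      \<longlonglongrightarrow> (sigma_series q + qpochhammer_inf q q) / 2"
    by (intro tendsto_intros T P) simp
  then have minus: "(\<lambda>N. ?s (2 * N)) \<longlonglongrightarrow> (sigma_series q + qpochhammer_inf q q) / 2"
    unfolding diff by (simp add: diff_divide_distrib)
  from plus minus show ?thesis
    unfolding sum_plus_def sum_minus_def by (auto simp: limI convergentI field_simps)
qed

end
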